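(* Let $\mu\in\mathcal{P}_2(\mathbf{R}^d)$ and $\rho:=\mathrm{P}^2_{\mathbf{R}^d}[\mu]$. Then $$\int_{\mathbf{R}^d}x\,\mathrm{d}\rho=\int_{\mathbf{R}^d}x\,\mathrm{d}\mu.$$
   Context: $\mathcal{P}_2(\mathbf{R}^d)$ is the set of Borel probability measures on $\mathbf{R}^d$ with finite second moment and $W_2$ is the $2$-Wasserstein distance. Let $\mathcal{K}_2(\mathbf{R}^d)$ be the set of $\rho\in\mathcal{P}_2(\mathbf{R}^d)$ that are absolutely continuous with respect to Lebesgue measure with density satisfying $0\le\rho\le1$ a.e. $\mathrm{P}^2_{\mathbf{R}^d}[\mu]$ denotes the metric projection of $\mu$ onto $\mathcal{K}_2(\mathbf{R}^d)$, i.e. the minimizer of $\rho\mapsto W_2^2(\rho,\mu)$ over $\rho\in\mathcal{K}_2(\mathbf{R}^d)$, which is known to exist and be unique. *)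

theory Defs
  imports "HOL-Probability.Probability"
begin

definition P2 :: "'a::euclidean_space measure set" where
  "P2 = {\<mu>. prob_space \<mu> \<and> sets \<mu> = sets borel \<and> integrable \<mu> (\<lambda>x. (norm x)\<^sup>2)}"

definition couplings ::
    "'a::euclidean_space measure \<Rightarrow> 'a measure \<Rightarrow> ('a \<times> 'a) measure set" where
  "couplings \<mu> \<nu> = {\<gamma>. prob_space \<gamma> \<and> sets \<gamma> = sets borel \<and>
     distr \<gamma> borel fst = \<mu> \<and> distr \<gamma> borel snd = \<nu>}"

(* The infimum lives in the extended nonnegative reals; it is finite whenever both
   measures lie in P2, since the product measure is a coupling of finite cost. Outside P2
   the value may be the dummy 0 = enn2real \<infinity>. *)
definition W2 :: "'a::euclidean_space measure \<Rightarrow> 'a measure \<Rightarrow> real" where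
  "W2 \<mu> \<nu> =
     sqrt (enn2real (INF \<gamma>\<in>couplings \<mu> \<nu>. \<integral>\<^sup>+ z. ennreal ((dist (fst z) (snd z))\<^sup>2) \<partial>\<gamma>))"

definition K2 :: "'a::euclidean_space measure set" where
  "K2 = {\<rho> \<in> P2. \<exists>f \<in> borel_measurable lborel.
     (AE x in lborel. 0 \<le> f x \<and> f x \<le> (1::real)) \<and> \<rho> = density lborel (\<lambda>x. ennreal (f x))}"

(* The minimizer is known to exist and to be unique for every \<mu> in P2, so the projection is
   rendered by its graph: this holds exactly when \<rho> is the metric projection of \<mu> onto K2. *)
definition is_K2_projection :: "'a::euclidean_space measure \<Rightarrow> 'a measure \<Rightarrow> bool" where
  "is_K2_projection \<mu> \<rho> \<longleftrightarrow> is_arg_min (\<lambda>\<sigma>. (W2 \<sigma> \<mu>)\<^sup>2) (\<lambda>\<sigma>. \<sigma> \<in> K2) \<rho>"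

end

theory Submission
  imports Defs
begin

text \<open>
  Let \<open>v\<close> be the difference of the barycentres of \<open>\<mu>\<close> and \<open>\<rho>\<close>. Translating \<open>\<rho>\<close> by \<open>v\<close> keeps the
  density constraint, and translating the first marginal of any coupling of \<open>\<rho>\<close> and \<open>\<mu>\<close> lowers its
  quadratic cost by exactly \<open>(norm v)\<^sup>2\<close>. Minimality of \<open>\<rho>\<close> therefore forces \<open>v = 0\<close>.
\<close>

text \<open>A probability measure integrates constants, so the second moment controls the first.
  This makes the barycentres genuine integrals instead of the default value 0 of a non-integrable
  function.\<close>

lemma P2_integrable_id:
  assumes "\<mu> \<in> P2"
  shows "integrable \<mu> (\<lambda>x. x)"
proof -
  interpret prob_space \<mu> using assms by (simp add: P2_def)
  have [measurable_cong]: "sets \<mu> = sets borel" using assms by (simp add: P2_def)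
  show ?thesis
  proof (rule Bochner_Integration.integrable_bound)
    show "integrable \<mu> (\<lambda>x. 1 + (norm x)\<^sup>2)" using assms by (simp add: P2_def)
    have "norm x \<le> 1 + (norm x)\<^sup>2" for x :: 'a
    proof -
      have "2 * norm x \<le> 1 + (norm x)\<^sup>2"
        using sum_squares_bound[of "norm x" 1] by simp
      then show ?thesis using norm_ge_zero[of x] by linarith
    qed
    then show "AE x in \<mu>. norm x \<le> norm (1 + (norm x)\<^sup>2)"
      by (simp add: add_nonneg_nonneg)
  qed measurable
qed

lemma P2_distr_plus:
  assumes "\<rho> \<in> P2"
  shows "distr \<rho> borel ((+) v) \<in> P2"
proof -
  interpret prob_space \<rho> using assms by (simp add: P2_def)
  have [measurable_cong]: "sets \<rho> = sets borel" using assms by (simp add: P2_def)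
  have [simp]: "integrable \<rho> (\<lambda>x. (norm x)\<^sup>2)" using assms by (simp add: P2_def)
  \<comment> \<open>The cross term is linear in \<open>x\<close>, so the first moment takes care of
    it.\<close>
  have "(norm (v + x))\<^sup>2 = (norm v)\<^sup>2 + 2 * (v \<bullet> x) + (norm x)\<^sup>2" for x
    by (simp add: power2_norm_eq_inner algebra_simps inner_commute)
  then have "integrable \<rho> (\<lambda>x. (norm (v + x))\<^sup>2)"
    using P2_integrable_id[OF assms] by simp
  moreover have "prob_space (distr \<rho> borel ((+) v))"
    by (rule prob_space_distr) measurable
  ultimately show ?thesis
    by (simp add: P2_def integrable_distr_eq)
qed

text \<open>Lebesgue measure is translation invariant, so the density is merely shifted and keeps
  its bounds. This makes the translate an admissible competitor.\<close>

lemma K2_distr_plus: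
  assumes "\<rho> \<in> K2"
  shows "distr \<rho> borel ((+) v) \<in> K2"
proof -
  obtain f where f [measurable]: "f \<in> borel_measurable lborel"
    and bnd: "AE x in lborel. 0 \<le> f x \<and> f x \<le> (1::real)"
    and \<rho>: "\<rho> = density lborel (\<lambda>x. ennreal (f x))" and "\<rho> \<in> P2"
    using assms by (auto simp: K2_def)
  have "(+) (- v) \<in> lborel \<rightarrow>\<^sub>M borel" by measurable
  \<comment> \<open>Invariance turns the bound on \<open>f\<close> into one for the image of
    \<open>lborel\<close> under the shift by \<open>- v\<close>, which \<open>AE_distrD\<close> then
    pulls back.\<close>
  moreover have "AE x in distr lborel borel ((+) (- v)). 0 \<le> f x \<and> f x \<le> 1"
    unfolding lborel_distr_plus by (rule bnd)
  ultimately have "AE x in lborel. 0 \<le> f (- v + x) \<and> f (- v + x) \<le> 1"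
    by (rule AE_distrD)
  \<comment> \<open>Composing the shifted density with \<open>(+) v\<close> gives back
    \<open>f\<close>, as \<open>density_distr\<close> requires.\<close>
  moreover have "distr \<rho> borel ((+) v) = density lborel (\<lambda>x. ennreal (f (- v + x)))"
    unfolding \<rho> using density_distr[of "\<lambda>x. ennreal (f (- v + x))" borel "(+) v" lborel]
    by (simp add: lborel_distr_plus)
  moreover have "(\<lambda>x. f (- v + x)) \<in> borel_measurable lborel"
    by measurable
  moreover have "distr \<rho> borel ((+) v) \<in> P2"
    by (rule P2_distr_plus[OF \<open>\<rho> \<in> P2\<close>])
  ultimately show ?thesis
    unfolding K2_def by (intro CollectI conjI bexI[of _ "\<lambda>x. f (- v + x)"])
qed

lemma couplingsD:
  assumes "\<gamma> \<in> couplings \<mu> \<nu>"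
  shows "prob_space \<gamma>" "sets \<gamma> = sets borel"
    "distr \<gamma> borel fst = \<mu>" "distr \<gamma> borel snd = \<nu>"
  using assms by (auto simp: couplings_def)

text \<open>Provides one concrete coupling, from which the transport cost is seen to be
  finite.\<close>

lemma pair_measure_in_couplings:
  fixes \<mu> \<nu> :: "'a::euclidean_space measure"
  assumes "prob_space \<mu>" "prob_space \<nu>" "sets \<mu> = sets borel" "sets \<nu> = sets borel"
  shows "\<mu> \<Otimes>\<^sub>M \<nu> \<in> couplings \<mu> \<nu>"
proof -
  interpret \<mu>: prob_space \<mu> by fact
  interpret \<nu>: prob_space \<nu> by fact
  interpret pair_prob_space \<mu> \<nu> ..
  note [measurable_cong] = assms(3,4)
  have "sets (\<mu> \<Otimes>\<^sub>M \<nu>) = sets borel"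
    unfolding borel_prod[symmetric] by (rule sets_pair_measure_cong[OF assms(3,4)])
  moreover have "distr (\<mu> \<Otimes>\<^sub>M \<nu>) borel fst = \<mu>"
  proof -
    have "distr (\<mu> \<Otimes>\<^sub>M \<nu>) borel fst = distr (\<mu> \<Otimes>\<^sub>M \<nu>) \<mu> fst"
      by (rule distr_cong) (simp_all add: assms)
    then show ?thesis by (simp add: \<nu>.distr_pair_fst)
  qed
  moreover have "distr (\<mu> \<Otimes>\<^sub>M \<nu>) borel snd = \<nu>"
  proof (rule measure_eqI)
    fix A assume "A \<in> sets (distr (\<mu> \<Otimes>\<^sub>M \<nu>) borel snd)"
    then have A: "A \<in> sets borel" by simp
    \<comment> \<open>The preimage is a rectangle whose first side has mass 1.\<close>
    then have "snd -` A \<inter> space (\<mu> \<Otimes>\<^sub>M \<nu>) = space \<mu> \<times> A"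
      using sets.sets_into_space[of A \<nu>] by (auto simp: space_pair_measure assms)
    then show "emeasure (distr (\<mu> \<Otimes>\<^sub>M \<nu>) borel snd) A = emeasure \<nu> A"
      using A \<nu>.emeasure_pair_measure_Times[of "space \<mu>" \<mu> A]
      by (simp add: emeasure_distr assms(4) \<mu>.emeasure_space_1)
  qed (simp add: assms)
  ultimately show ?thesis
    by (simp add: couplings_def prob_space_axioms)
qed

text \<open>Change of variables: the marginal is the image of \<open>\<gamma>\<close> under
  \<open>fst\<close>. The analogue for \<open>snd\<close> follows.\<close>

lemma coupling_integrable_fst:
  fixes f :: "'a::euclidean_space \<Rightarrow> 'b::{banach, second_countable_topology}"
  assumes "\<gamma> \<in> couplings \<mu> \<nu>" "integrable \<mu> f"
  shows "integrable \<gamma> (\<lambda>z. f (fst z))" "(\<integral>z. f (fst z) \<partial>\<gamma>) = (\<integral>x. f x \<partial>\<mu>)"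
proof -
  have [measurable_cong]: "sets \<gamma> = sets (borel \<Otimes>\<^sub>M borel)"
    unfolding borel_prod by (rule couplingsD(2)[OF assms(1)])
  have \<mu>: "\<mu> = distr \<gamma> borel fst" using couplingsD(3)[OF assms(1)] by simp
  have [measurable]: "f \<in> borel_measurable borel"
    using assms(2) unfolding \<mu> by (simp add: borel_measurable_integrable)
  show "integrable \<gamma> (\<lambda>z. f (fst z))"
    using assms(2) unfolding \<mu> by (simp add: integrable_distr_eq)
  show "(\<integral>z. f (fst z) \<partial>\<gamma>) = (\<integral>x. f x \<partial>\<mu>)"
    unfolding \<mu> by (simp add: integral_distr)
qed

lemma coupling_integrable_snd:
  fixes f :: "'a::euclidean_space \<Rightarrow> 'b::{banach, second_countable_topology}"
  assumes "\<gamma> \<in> couplings \<mu> \<nu>" "integrable \<nu> f"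
  shows "integrable \<gamma> (\<lambda>z. f (snd z))" "(\<integral>z. f (snd z) \<partial>\<gamma>) = (\<integral>x. f x \<partial>\<nu>)"
proof -
  have [measurable_cong]: "sets \<gamma> = sets (borel \<Otimes>\<^sub>M borel)"
    unfolding borel_prod by (rule couplingsD(2)[OF assms(1)])
  have \<nu>: "\<nu> = distr \<gamma> borel snd" using couplingsD(4)[OF assms(1)] by simp
  have [measurable]: "f \<in> borel_measurable borel"
    using assms(2) unfolding \<nu> by (simp add: borel_measurable_integrable)
  show "integrable \<gamma> (\<lambda>z. f (snd z))"
    using assms(2) unfolding \<nu> by (simp add: integrable_distr_eq)
  show "(\<integral>z. f (snd z) \<partial>\<gamma>) = (\<integral>x. f x \<partial>\<nu>)"
    unfolding \<nu> by (simp add: integral_distr)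
qed

lemma coupling_integrable_dist:
  fixes \<mu> \<nu> :: "'a::euclidean_space measure"
  assumes \<gamma>: "\<gamma> \<in> couplings \<mu> \<nu>" and \<mu>: "\<mu> \<in> P2" and \<nu>: "\<nu> \<in> P2"
  shows "integrable \<gamma> (\<lambda>z. (dist (fst z) (snd z))\<^sup>2)"
proof (rule Bochner_Integration.integrable_bound)
  have [measurable_cong]: "sets \<gamma> = sets (borel \<Otimes>\<^sub>M borel)"
    unfolding borel_prod by (rule couplingsD(2)[OF \<gamma>])
  show "(\<lambda>z. (dist (fst z) (snd z))\<^sup>2) \<in> borel_measurable \<gamma>" by measurable
  have "integrable \<gamma> (\<lambda>z. (norm (fst z))\<^sup>2)" "integrable \<gamma> (\<lambda>z. (norm (snd z))\<^sup>2)"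
    using \<mu> \<nu> coupling_integrable_fst(1)[OF \<gamma>] coupling_integrable_snd(1)[OF \<gamma>]
    by (auto simp: P2_def)
  then show "integrable \<gamma> (\<lambda>z. 2 * (norm (fst z))\<^sup>2 + 2 * (norm (snd z))\<^sup>2)" by simp
  \<comment> \<open>Parallelogram law: the two sides differ by the square of
    \<open>norm (x + y)\<close>.\<close>
  have "(dist x y)\<^sup>2 \<le> 2 * (norm x)\<^sup>2 + 2 * (norm y)\<^sup>2" for x y :: 'a
    using zero_le_power2[of "norm (x + y)"]
    by (simp only: dist_norm power2_norm_eq_inner) (simp add: algebra_simps inner_commute)
  then show "AE z in \<gamma>. norm ((dist (fst z) (snd z))\<^sup>2)
      \<le> norm (2 * (norm (fst z))\<^sup>2 + 2 * (norm (snd z))\<^sup>2)"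
    by auto
qed

text \<open>Allows costs to be computed with real integrals, where the signed cross term makes
  sense.\<close>

lemma nn_integral_coupling_dist:
  fixes \<mu> \<nu> :: "'a::euclidean_space measure"
  assumes "\<gamma> \<in> couplings \<mu> \<nu>" "\<mu> \<in> P2" "\<nu> \<in> P2"
  shows "(\<integral>\<^sup>+z. ennreal ((dist (fst z) (snd z))\<^sup>2) \<partial>\<gamma>) = ennreal (\<integral>z. (dist (fst z) (snd z))\<^sup>2 \<partial>\<gamma>)"
  by (rule nn_integral_eq_integral[OF coupling_integrable_dist[OF assms]]) simp

lemma coupling_translate:
  assumes \<gamma>: "\<gamma> \<in> couplings \<rho> \<mu>"
  shows "distr \<gamma> borel (\<lambda>z. (v + fst z, snd z)) \<in> couplings (distr \<rho> borel ((+) v)) \<mu>"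
proof -
  interpret prob_space \<gamma> using couplingsD(1)[OF \<gamma>] .
  have [measurable_cong]: "sets \<gamma> = sets (borel \<Otimes>\<^sub>M borel)"
    unfolding borel_prod by (rule couplingsD(2)[OF \<gamma>])
  \<comment> \<open>Measurability is checked for the product sigma-algebra, which
    \<open>borel_prod\<close> identifies with \<open>borel\<close>.\<close>
  have T: "(\<lambda>z. (v + fst z, snd z)) \<in> \<gamma> \<rightarrow>\<^sub>M borel"
    unfolding borel_prod[symmetric] by measurable
  have pr: "fst \<in> (borel :: ('a \<times> 'a) measure) \<rightarrow>\<^sub>M borel" "snd \<in> (borel :: ('a \<times> 'a) measure) \<rightarrow>\<^sub>M borel"
    unfolding borel_prod[symmetric] by measurable
  have "distr (distr \<gamma> borel (\<lambda>z. (v + fst z, snd z))) borel fst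
      = distr (distr \<gamma> borel fst) borel ((+) v)"
    by (simp add: distr_distr T pr comp_def)
  moreover have "distr (distr \<gamma> borel (\<lambda>z. (v + fst z, snd z))) borel snd = distr \<gamma> borel snd"
    by (simp add: distr_distr T pr comp_def)
  ultimately show ?thesis
    using prob_space_distr[OF T] couplingsD(3,4)[OF \<gamma>] by (simp add: couplings_def)
qed

text \<open>Expanding the square adds a linear term with integral
  \<open>- 2 * (norm v)\<^sup>2\<close> and the constant \<open>(norm v)\<^sup>2\<close>. Among all
  translations of the first marginal, this \<open>v\<close> lowers the cost the most.\<close>

lemma coupling_translate_cost:
  fixes \<rho> \<mu> :: "'a::euclidean_space measure" and v :: 'a
  defines "v \<equiv> (\<integral>x. x \<partial>\<mu>) - (\<integral>x. x \<partial>\<rho>)"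
  assumes \<gamma>: "\<gamma> \<in> couplings \<rho> \<mu>" and \<rho>: "\<rho> \<in> P2" and \<mu>: "\<mu> \<in> P2"
  shows "(\<integral>z. (dist (fst z) (snd z))\<^sup>2 \<partial>(distr \<gamma> borel (\<lambda>z. (v + fst z, snd z)))) + (norm v)\<^sup>2
    = (\<integral>z. (dist (fst z) (snd z))\<^sup>2 \<partial>\<gamma>)"
proof -
  interpret prob_space \<gamma> using couplingsD(1)[OF \<gamma>] .
  have [measurable_cong]: "sets \<gamma> = sets (borel \<Otimes>\<^sub>M borel)"
    unfolding borel_prod by (rule couplingsD(2)[OF \<gamma>])
  note fst = coupling_integrable_fst[OF \<gamma> P2_integrable_id[OF \<rho>]]
  note snd = coupling_integrable_snd[OF \<gamma> P2_integrable_id[OF \<mu>]]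
  have "(dist (v + x) y)\<^sup>2 = (dist x y)\<^sup>2 + 2 * (v \<bullet> (x - y)) + (norm v)\<^sup>2" for x y
    by (simp only: dist_norm power2_norm_eq_inner) (simp add: algebra_simps inner_commute)
  moreover have "(\<integral>z. (dist (fst z) (snd z))\<^sup>2 \<partial>(distr \<gamma> borel (\<lambda>z. (v + fst z, snd z))))
      = (\<integral>z. (dist (v + fst z) (snd z))\<^sup>2 \<partial>\<gamma>)"
    unfolding borel_prod[symmetric] by (subst integral_distr) auto
  \<comment> \<open>The mean of \<open>fst z - snd z\<close> depends only on the marginals and
    equals \<open>- v\<close>.\<close>
  moreover have "(\<integral>z. v \<bullet> (fst z - snd z) \<partial>\<gamma>) = - (norm v)\<^sup>2"
    using fst snd by (simp add: v_def power2_norm_eq_inner flip: inner_minus_right)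
  ultimately show ?thesis
    using coupling_integrable_dist[OF \<gamma> \<rho> \<mu>] fst(1) snd(1) by (simp add: prob_space)
qed

lemma W2_squared:
  "(W2 \<mu> \<nu>)\<^sup>2 = enn2real (INF \<gamma>\<in>couplings \<mu> \<nu>. \<integral>\<^sup>+ z. ennreal ((dist (fst z) (snd z))\<^sup>2) \<partial>\<gamma>)"
  by (simp add: W2_def)

text \<open>Guards against \<open>enn2real\<close> sending an infinite cost to 0, which would break
  monotonicity and additivity.\<close>

lemma transport_cost_finite:
  fixes \<mu> \<nu> :: "'a::euclidean_space measure"
  assumes "\<mu> \<in> P2" "\<nu> \<in> P2"
  shows "(INF \<gamma>\<in>couplings \<mu> \<nu>. \<integral>\<^sup>+ z. ennreal ((dist (fst z) (snd z))\<^sup>2) \<partial>\<gamma>) < \<infinity>"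
proof -
  have prod: "\<mu> \<Otimes>\<^sub>M \<nu> \<in> couplings \<mu> \<nu>"
    using assms by (intro pair_measure_in_couplings) (auto simp: P2_def)
  show ?thesis
    by (rule le_less_trans[OF INF_lower[OF prod]]) (simp add: nn_integral_coupling_dist[OF prod assms])
qed

text \<open>The cost drops by the same amount for every coupling, so the drop survives passing to
  the infimum.\<close>

lemma W2_translate_le:
  fixes \<rho> \<mu> :: "'a::euclidean_space measure" and v :: 'a
  defines "v \<equiv> (\<integral>x. x \<partial>\<mu>) - (\<integral>x. x \<partial>\<rho>)"
  assumes \<rho>: "\<rho> \<in> P2" and \<mu>: "\<mu> \<in> P2"
  shows "(W2 (distr \<rho> borel ((+) v)) \<mu>)\<^sup>2 + (norm v)\<^sup>2 \<le> (W2 \<rho> \<mu>)\<^sup>2"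
proof -
  define C where "C \<gamma> = (\<integral>\<^sup>+ z. ennreal ((dist (fst z) (snd z))\<^sup>2) \<partial>\<gamma>)" for \<gamma> :: "('a \<times> 'a) measure"
  define \<rho>' where "\<rho>' = distr \<rho> borel ((+) v)"
  have \<rho>': "\<rho>' \<in> P2" unfolding \<rho>'_def by (rule P2_distr_plus[OF \<rho>])
  have "(INF \<gamma>\<in>couplings \<rho>' \<mu>. C \<gamma>) + ennreal ((norm v)\<^sup>2) \<le> C \<gamma>" if \<gamma>: "\<gamma> \<in> couplings \<rho> \<mu>" for \<gamma>
  proof -
    define \<gamma>' where "\<gamma>' = distr \<gamma> borel (\<lambda>z. (v + fst z, snd z))"
    have \<gamma>': "\<gamma>' \<in> couplings \<rho>' \<mu>"
      unfolding \<gamma>'_def \<rho>'_def by (rule coupling_translate[OF \<gamma>])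
    have "C \<gamma>' + ennreal ((norm v)\<^sup>2)
        = ennreal ((\<integral>z. (dist (fst z) (snd z))\<^sup>2 \<partial>\<gamma>') + (norm v)\<^sup>2)"
      unfolding C_def nn_integral_coupling_dist[OF \<gamma>' \<rho>' \<mu>] by simp
    also have "\<dots> = C \<gamma>"
      unfolding C_def nn_integral_coupling_dist[OF \<gamma> \<rho> \<mu>] \<gamma>'_def
      using coupling_translate_cost[OF \<gamma> \<rho> \<mu>] by (simp add: v_def)
    finally show ?thesis
      using add_right_mono[OF INF_lower[OF \<gamma>', of C], of "ennreal ((norm v)\<^sup>2)"] by simp
  qed
  then have "(INF \<gamma>\<in>couplings \<rho>' \<mu>. C \<gamma>) + ennreal ((norm v)\<^sup>2) \<le> (INF \<gamma>\<in>couplings \<rho> \<mu>. C \<gamma>)"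
    by (rule INF_greatest)
  \<comment> \<open>Monotonicity of \<open>enn2real\<close> needs the right-hand infimum to be
    finite; splitting the sum afterwards needs the left-hand one to be finite.\<close>
  then have "enn2real ((INF \<gamma>\<in>couplings \<rho>' \<mu>. C \<gamma>) + ennreal ((norm v)\<^sup>2))
      \<le> enn2real (INF \<gamma>\<in>couplings \<rho> \<mu>. C \<gamma>)"
    using transport_cost_finite[OF \<rho> \<mu>] by (intro enn2real_mono) (simp_all add: C_def)
  then show ?thesis
    using transport_cost_finite[OF \<rho>' \<mu>]
    by (simp add: W2_squared enn2real_plus C_def flip: \<rho>'_def)
qed

theorem proposition2p1:
  fixes \<mu> \<rho> :: "(real ^ 'n) measure"
  assumes "\<mu> \<in> P2"
    and "is_K2_projection \<mu> \<rho>"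
  shows "(\<integral>x. x \<partial>\<rho>) = (\<integral>x. x \<partial>\<mu>)"
proof -
  define v where "v = (\<integral>x. x \<partial>\<mu>) - (\<integral>x. x \<partial>\<rho>)"
  have min: "(W2 \<rho> \<mu>)\<^sup>2 \<le> (W2 \<sigma> \<mu>)\<^sup>2" if "\<sigma> \<in> K2" for \<sigma>
    using assms(2) that by (auto simp: is_K2_projection_def is_arg_min_linorder)
  have "\<rho> \<in> K2"
    using assms(2) by (simp add: is_K2_projection_def is_arg_min_def)
  then have "\<rho> \<in> P2" by (simp add: K2_def)
  \<comment> \<open>The translate costs at least as much as \<open>\<rho>\<close> by minimality, yet
    less by at least \<open>(norm v)\<^sup>2\<close>.\<close>
  have "(norm v)\<^sup>2 \<le> 0"
    using min[OF K2_distr_plus[OF \<open>\<rho> \<in> K2\<close>, of v]] W2_translate_le[OF \<open>\<rho> \<in> P2\<close> assms(1)]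
    unfolding v_def by linarith
  then show ?thesis by (simp add: v_def)
qed

end
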